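(* Let $\mathcal{E}$ be a topos satisfying NS and WDQO. If $T$ is a connected object with a point $0:1\to T$ and $A$ is decidable, then $\mathrm{ev}^0_A:A^T\to A$ is an isomorphism.
   Context: A point of $X$ is an arrow $1\to X$. An object of a topos is decidable if its diagonal is a complemented subobject; $\mathcal{I}:\mathrm{Dec}(\mathcal{E})\to\mathcal{E}$ is the inclusion of the full subcategory of decidable objects. NS: every non-initial object has a point. WDQO: for every object $X$ there is a minimal decidable object, $p_X:X\to\Pi(X)$ with $\Pi(X)$ decidable, such that every arrow $X\to1+1$ factors uniquely through $p_X$. For a topos satisfying NS and WDQO, $\Pi$ is a finite-product-preserving functor left adjoint to $\mathcal{I}$ with unit $p$. An object $T$ is connected if $\Pi(T)=1$. For a point $t:1\to T$, $\mathrm{ev}^t_X:X^T\to X$ is the composite $X^T\xrightarrow{\langle1,!\rangle}X^T\times1\xrightarrow{1\times t}X^T\times T\xrightarrow{\mathrm{ev}}X$. *)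

theory Defs
  imports Main
begin

section \<open>Categories\<close>

record ('o, 'a) cat =
  obj :: "'o set"
  arr :: "'a set"
  src :: "'a \<Rightarrow> 'o"
  tgt :: "'a \<Rightarrow> 'o"
  ident :: "'o \<Rightarrow> 'a"
  compose :: "'a \<Rightarrow> 'a \<Rightarrow> 'a"  (infixr "\<cdot>\<index>" 70)

text \<open>Composition is in applicative order: \<open>g \<cdot> f\<close> is \<open>f\<close> followed by \<open>g\<close>.\<close>

definition hom :: "('o, 'a, 'm) cat_scheme \<Rightarrow> 'o \<Rightarrow> 'o \<Rightarrow> 'a set" where
  "hom C X Y = {f \<in> arr C. src C f = X \<and> tgt C f = Y}"

locale category =
  fixes C :: "('o, 'a, 'm) cat_scheme" (structure)
  assumes src_closed: "f \<in> arr C \<Longrightarrow> src C f \<in> obj C"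
    and tgt_closed: "f \<in> arr C \<Longrightarrow> tgt C f \<in> obj C"
    and ident_closed: "X \<in> obj C \<Longrightarrow> ident C X \<in> hom C X X"
    and comp_closed: "\<lbrakk>f \<in> hom C X Y; g \<in> hom C Y Z\<rbrakk> \<Longrightarrow> g \<cdot> f \<in> hom C X Z"
    and comp_ident: "f \<in> hom C X Y \<Longrightarrow> f \<cdot> ident C X = f"
    and ident_comp: "f \<in> hom C X Y \<Longrightarrow> ident C Y \<cdot> f = f"
    and comp_assoc: "\<lbrakk>f \<in> hom C W X; g \<in> hom C X Y; h \<in> hom C Y Z\<rbrakk>
      \<Longrightarrow> (h \<cdot> g) \<cdot> f = h \<cdot> (g \<cdot> f)"

definition monic :: "('o, 'a, 'm) cat_scheme \<Rightarrow> 'a \<Rightarrow> bool" where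
  "monic C m \<longleftrightarrow> m \<in> arr C \<and>
     (\<forall>X. \<forall>f \<in> hom C X (src C m). \<forall>g \<in> hom C X (src C m).
        m \<cdot>\<^bsub>C\<^esub> f = m \<cdot>\<^bsub>C\<^esub> g \<longrightarrow> f = g)"

definition is_iso :: "('o, 'a, 'm) cat_scheme \<Rightarrow> 'a \<Rightarrow> bool" where
  "is_iso C f \<longleftrightarrow> f \<in> arr C \<and>
     (\<exists>g \<in> hom C (tgt C f) (src C f).
        g \<cdot>\<^bsub>C\<^esub> f = ident C (src C f) \<and> f \<cdot>\<^bsub>C\<^esub> g = ident C (tgt C f))"

definition isomorphic :: "('o, 'a, 'm) cat_scheme \<Rightarrow> 'o \<Rightarrow> 'o \<Rightarrow> bool" where
  "isomorphic C X Y \<longleftrightarrow> (\<exists>f \<in> hom C X Y. is_iso C f)"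


section \<open>Universal constructions\<close>

text \<open>
  Objects with a universal property are not chosen once and for all: each construction
  is a predicate on an object together with its structure arrows.
\<close>

definition is_terminal :: "('o, 'a, 'm) cat_scheme \<Rightarrow> 'o \<Rightarrow> bool" where
  "is_terminal C one \<longleftrightarrow> one \<in> obj C \<and> (\<forall>X \<in> obj C. \<exists>!f. f \<in> hom C X one)"

definition is_initial :: "('o, 'a, 'm) cat_scheme \<Rightarrow> 'o \<Rightarrow> bool" where
  "is_initial C Z \<longleftrightarrow> Z \<in> obj C \<and> (\<forall>X \<in> obj C. \<exists>!f. f \<in> hom C Z X)"

definition is_product ::
  "('o, 'a, 'm) cat_scheme \<Rightarrow> 'o \<Rightarrow> 'o \<Rightarrow> 'o \<Rightarrow> 'a \<Rightarrow> 'a \<Rightarrow> bool" where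
  "is_product C X Y P p q \<longleftrightarrow> p \<in> hom C P X \<and> q \<in> hom C P Y \<and>
     (\<forall>W. \<forall>f \<in> hom C W X. \<forall>g \<in> hom C W Y.
        \<exists>!h. h \<in> hom C W P \<and> p \<cdot>\<^bsub>C\<^esub> h = f \<and> q \<cdot>\<^bsub>C\<^esub> h = g)"

definition is_coproduct ::
  "('o, 'a, 'm) cat_scheme \<Rightarrow> 'o \<Rightarrow> 'o \<Rightarrow> 'o \<Rightarrow> 'a \<Rightarrow> 'a \<Rightarrow> bool" where
  "is_coproduct C X Y S i j \<longleftrightarrow> i \<in> hom C X S \<and> j \<in> hom C Y S \<and>
     (\<forall>W. \<forall>f \<in> hom C X W. \<forall>g \<in> hom C Y W.
        \<exists>!h. h \<in> hom C S W \<and> h \<cdot>\<^bsub>C\<^esub> i = f \<and> h \<cdot>\<^bsub>C\<^esub> j = g)"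

definition is_pullback ::
  "('o, 'a, 'm) cat_scheme \<Rightarrow> 'a \<Rightarrow> 'a \<Rightarrow> 'o \<Rightarrow> 'a \<Rightarrow> 'a \<Rightarrow> bool" where
  "is_pullback C f g P p q \<longleftrightarrow>
     f \<in> arr C \<and> g \<in> arr C \<and> tgt C f = tgt C g \<and>
     p \<in> hom C P (src C f) \<and> q \<in> hom C P (src C g) \<and> f \<cdot>\<^bsub>C\<^esub> p = g \<cdot>\<^bsub>C\<^esub> q \<and>
     (\<forall>W. \<forall>u \<in> hom C W (src C f). \<forall>v \<in> hom C W (src C g).
        f \<cdot>\<^bsub>C\<^esub> u = g \<cdot>\<^bsub>C\<^esub> v \<longrightarrow>
        (\<exists>!h. h \<in> hom C W P \<and> p \<cdot>\<^bsub>C\<^esub> h = u \<and> q \<cdot>\<^bsub>C\<^esub> h = v))"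

definition bang :: "('o, 'a, 'm) cat_scheme \<Rightarrow> 'o \<Rightarrow> 'o \<Rightarrow> 'a" where
  "bang C one X = (THE f. f \<in> hom C X one)"

text \<open>\<open>pairing C p q f g\<close> is the arrow \<open>\<langle>f, g\<rangle>\<close> into the product with projections \<open>p\<close>, \<open>q\<close>.\<close>

definition pairing :: "('o, 'a, 'm) cat_scheme \<Rightarrow> 'a \<Rightarrow> 'a \<Rightarrow> 'a \<Rightarrow> 'a \<Rightarrow> 'a" where
  "pairing C p q f g =
     (THE h. h \<in> hom C (src C f) (src C p) \<and> p \<cdot>\<^bsub>C\<^esub> h = f \<and> q \<cdot>\<^bsub>C\<^esub> h = g)"

text \<open>
  \<open>prod_map C p q p' q' f g\<close> is \<open>f \<times> g\<close>, from the product with projections \<open>p\<close>, \<open>q\<close>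
  to the one with projections \<open>p'\<close>, \<open>q'\<close>.
\<close>

definition prod_map ::
  "('o, 'a, 'm) cat_scheme \<Rightarrow> 'a \<Rightarrow> 'a \<Rightarrow> 'a \<Rightarrow> 'a \<Rightarrow> 'a \<Rightarrow> 'a \<Rightarrow> 'a" where
  "prod_map C p q p' q' f g = pairing C p' q' (f \<cdot>\<^bsub>C\<^esub> p) (g \<cdot>\<^bsub>C\<^esub> q)"

text \<open>
  \<open>is_exponential C X T E P p q ev\<close>: \<open>E\<close> is \<open>X\<^sup>T\<close>, with evaluation \<open>ev : E \<times> T \<rightarrow> X\<close>,
  where \<open>P\<close> with projections \<open>p\<close>, \<open>q\<close> is the product \<open>E \<times> T\<close>.
\<close>

definition is_exponential ::
  "('o, 'a, 'm) cat_scheme \<Rightarrow> 'o \<Rightarrow> 'o \<Rightarrow> 'o \<Rightarrow> 'o \<Rightarrow> 'a \<Rightarrow> 'a \<Rightarrow> 'a \<Rightarrow> bool" where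
  "is_exponential C X T E P p q ev \<longleftrightarrow>
     is_product C E T P p q \<and> ev \<in> hom C P X \<and>
     (\<forall>W R r s. is_product C W T R r s \<longrightarrow>
        (\<forall>f \<in> hom C R X.
           \<exists>!h. h \<in> hom C W E \<and> ev \<cdot>\<^bsub>C\<^esub> prod_map C r s p q h (ident C T) = f))"

definition is_subobject_classifier ::
  "('o, 'a, 'm) cat_scheme \<Rightarrow> 'o \<Rightarrow> 'o \<Rightarrow> 'a \<Rightarrow> bool" where
  "is_subobject_classifier C one \<Omega> true \<longleftrightarrow>
     is_terminal C one \<and> true \<in> hom C one \<Omega> \<and>
     (\<forall>m. monic C m \<longrightarrow>
        (\<exists>!\<chi>. \<chi> \<in> hom C (tgt C m) \<Omega> \<and>
              is_pullback C \<chi> true (src C m) m (bang C one (src C m))))"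


section \<open>Toposes\<close>

text \<open>
  Finite limits are given as a terminal object and pullbacks. Finite colimits are not
  part of the definition: they exist in every elementary topos.
\<close>

locale topos = category C
  for C :: "('o, 'a, 'm) cat_scheme" (structure) +
  assumes has_terminal: "\<exists>one. is_terminal C one"
    and has_pullbacks: "\<lbrakk>f \<in> arr C; g \<in> arr C; tgt C f = tgt C g\<rbrakk>
      \<Longrightarrow> \<exists>P p q. is_pullback C f g P p q"
    and has_exponentials: "\<lbrakk>X \<in> obj C; T \<in> obj C\<rbrakk>
      \<Longrightarrow> \<exists>E P p q ev. is_exponential C X T E P p q ev"
    and has_subobject_classifier: "\<exists>one \<Omega> true. is_subobject_classifier C one \<Omega> true"


section \<open>Decidable and connected objects\<close>

definition is_complemented :: "('o, 'a, 'm) cat_scheme \<Rightarrow> 'a \<Rightarrow> bool" where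
  "is_complemented C m \<longleftrightarrow> monic C m \<and>
     (\<exists>m'. monic C m' \<and> is_coproduct C (src C m) (src C m') (tgt C m) m m')"

definition decidable :: "('o, 'a, 'm) cat_scheme \<Rightarrow> 'o \<Rightarrow> bool" where
  "decidable C X \<longleftrightarrow> X \<in> obj C \<and>
     (\<exists>P p q. is_product C X X P p q \<and>
        is_complemented C (pairing C p q (ident C X) (ident C X)))"

definition NS :: "('o, 'a, 'm) cat_scheme \<Rightarrow> bool" where
  "NS C \<longleftrightarrow> (\<forall>X \<in> obj C. \<not> is_initial C X \<longrightarrow>
     (\<exists>one x. is_terminal C one \<and> x \<in> hom C one X))"

text \<open>
  \<open>minimal_decidable C X P p\<close>: the arrow \<open>p : X \<rightarrow> P\<close> may serve as \<open>p\<^sub>X : X \<rightarrow> \<Pi>(X)\<close>.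
  In a topos the coproduct \<open>S = 1 + 1\<close> exists, so the quantification over it is not vacuous;
  it is unique up to isomorphism, so the condition does not depend on the coproduct taken.
\<close>

definition minimal_decidable ::
  "('o, 'a, 'm) cat_scheme \<Rightarrow> 'o \<Rightarrow> 'o \<Rightarrow> 'a \<Rightarrow> bool" where
  "minimal_decidable C X P p \<longleftrightarrow> decidable C P \<and> p \<in> hom C X P \<and>
     (\<forall>one S i j. is_terminal C one \<and> is_coproduct C one one S i j \<longrightarrow>
        (\<forall>f \<in> hom C X S. \<exists>!g. g \<in> hom C P S \<and> g \<cdot>\<^bsub>C\<^esub> p = f))"

definition WDQO :: "('o, 'a, 'm) cat_scheme \<Rightarrow> bool" where
  "WDQO C \<longleftrightarrow> (\<forall>X \<in> obj C. \<exists>P p. minimal_decidable C X P p)"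

text \<open>
  Under NS and WDQO, \<open>\<Pi>(T)\<close> is determined up to isomorphism, so \<open>\<Pi>(T) = 1\<close> is read as:
  some minimal decidable object of \<open>T\<close> is isomorphic to a terminal object.
\<close>

definition connected :: "('o, 'a, 'm) cat_scheme \<Rightarrow> 'o \<Rightarrow> bool" where
  "connected C T \<longleftrightarrow> T \<in> obj C \<and>
     (\<exists>P p one. minimal_decidable C T P p \<and> is_terminal C one \<and> isomorphic C P one)"

text \<open>
  The composite \<open>E \<rightarrow> E \<times> 1 \<rightarrow> E \<times> T \<rightarrow> X\<close> of \<open>\<langle>1, !\<rangle>\<close>, \<open>1 \<times> t\<close> and \<open>ev\<close>, where
  \<open>r\<close>, \<open>s\<close> are the projections of \<open>E \<times> 1\<close> and \<open>p\<close>, \<open>q\<close> those of \<open>E \<times> T\<close>.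
\<close>

definition ev_at ::
  "('o, 'a, 'm) cat_scheme \<Rightarrow> 'o \<Rightarrow> 'o \<Rightarrow> 'a \<Rightarrow> 'a \<Rightarrow> 'a \<Rightarrow> 'a \<Rightarrow> 'a \<Rightarrow> 'a \<Rightarrow> 'a" where
  "ev_at C one E r s p q ev t =
     ev \<cdot>\<^bsub>C\<^esub> prod_map C r s p q (ident C E) t \<cdot>\<^bsub>C\<^esub> pairing C r s (ident C E) (bang C one E)"

end

theory Submission
  imports Defs
begin

text \<open>
  It suffices that \<open>ev(w, t) = ev(w, 0)\<close> on \<open>A\<^sup>T \<times> T\<close>, for then the transpose of the projection
  \<open>A \<times> T \<rightarrow> A\<close> is inverse to evaluation at \<open>0\<close>. Let \<open>D\<close> be the pullback of the complement of the
  diagonal of \<open>A\<close> along \<open>\<langle>ev(w, t), ev(w, 0)\<rangle>\<close>. If \<open>D\<close> is initial, this arrow factors through the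
  diagonal. Otherwise NS gives a point \<open>(w, t)\<close> of \<open>D\<close>. Then \<open>ev(w, -)\<close> yields an arrow
  \<open>T \<rightarrow> 1 + 1\<close> that takes the two injections as values at \<open>0\<close> and \<open>t\<close>. As \<open>T\<close> is connected,
  the injections coincide, hence any two points of any object are equal, and transposing
  to points of exponentials so are any two parallel arrows.

  Only in the second case is a coproduct \<open>1 + 1\<close> needed, and there it can be split off \<open>A\<close>,
  so the general construction of colimits in a topos is not used.
\<close>

section \<open>Universal arrows in a category\<close>

context category
begin

lemma hom_src_obj: "f \<in> hom C X Y \<Longrightarrow> X \<in> obj C"
  using src_closed by (auto simp: hom_def)

lemma hom_tgt_obj: "f \<in> hom C X Y \<Longrightarrow> Y \<in> obj C"
  using tgt_closed by (auto simp: hom_def)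

lemma terminal_eq: "\<lbrakk>is_terminal C one; f \<in> hom C X one; g \<in> hom C X one\<rbrakk> \<Longrightarrow> f = g"
  using hom_src_obj unfolding is_terminal_def by blast

lemma initial_eq: "\<lbrakk>is_initial C Z; f \<in> hom C Z X; g \<in> hom C Z X\<rbrakk> \<Longrightarrow> f = g"
  using hom_tgt_obj unfolding is_initial_def by blast

lemma bang_in_hom: "\<lbrakk>is_terminal C one; X \<in> obj C\<rbrakk> \<Longrightarrow> bang C one X \<in> hom C X one"
  unfolding is_terminal_def bang_def by (metis (no_types, lifting) theI')

lemma terminal_comp_bang:
  assumes "is_terminal C one" "f \<in> hom C X Y"
  shows "bang C one Y \<cdot> f = bang C one X"
  using assms bang_in_hom comp_closed hom_src_obj hom_tgt_obj terminal_eq by metis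

lemma product_obj: "is_product C X Y P p q \<Longrightarrow> P \<in> obj C"
  unfolding is_product_def using hom_src_obj by blast

lemma pairing_props:
  assumes "is_product C X Y P p q" "f \<in> hom C W X" "g \<in> hom C W Y"
  shows "pairing C p q f g \<in> hom C W P" "p \<cdot> pairing C p q f g = f" "q \<cdot> pairing C p q f g = g"
proof -
  have "\<exists>!h. h \<in> hom C (src C f) (src C p) \<and> p \<cdot> h = f \<and> q \<cdot> h = g"
  proof -
    have "src C f = W" "src C p = P"
      using assms unfolding is_product_def by (auto simp: hom_def)
    then show ?thesis
      using assms unfolding is_product_def by blast
  qed
  from theI'[OF this] show "pairing C p q f g \<in> hom C W P"
    "p \<cdot> pairing C p q f g = f" "q \<cdot> pairing C p q f g = g"
    using assms unfolding pairing_def is_product_def by (auto simp: hom_def)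
qed

lemma product_eqI:
  assumes "is_product C X Y P p q" "h \<in> hom C W P" "k \<in> hom C W P" "p \<cdot> h = p \<cdot> k" "q \<cdot> h = q \<cdot> k"
  shows "h = k"
proof -
  have "p \<cdot> k \<in> hom C W X" "q \<cdot> k \<in> hom C W Y"
    using assms comp_closed unfolding is_product_def by blast+
  then show ?thesis
    using assms unfolding is_product_def by metis
qed

lemma pairing_comp:
  assumes P: "is_product C X Y P p q" and f: "f \<in> hom C W X" and g: "g \<in> hom C W Y"
    and k: "k \<in> hom C V W"
  shows "pairing C p q f g \<cdot> k = pairing C p q (f \<cdot> k) (g \<cdot> k)"
proof -
  have p: "p \<in> hom C P X" and q: "q \<in> hom C P Y"
    using P unfolding is_product_def by auto
  note fg = pairing_props[OF P f g]
  note fgk = pairing_props[OF P comp_closed[OF k f] comp_closed[OF k g]]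
  show ?thesis
    using fg fgk comp_assoc[OF k fg(1) p] comp_assoc[OF k fg(1) q]
    by (intro product_eqI[OF P comp_closed[OF k fg(1)] fgk(1)]) simp_all
qed

lemma pairing_eta:
  assumes P: "is_product C X Y P p q" and h: "h \<in> hom C W P"
  shows "pairing C p q (p \<cdot> h) (q \<cdot> h) = h"
proof -
  have p: "p \<in> hom C P X" and q: "q \<in> hom C P Y"
    using P unfolding is_product_def by auto
  note pr = pairing_props[OF P comp_closed[OF h p] comp_closed[OF h q]]
  show ?thesis
    by (rule product_eqI[OF P pr(1) h pr(2,3)])
qed

lemma prod_map_props:
  assumes R: "is_product C W T R r s" and P: "is_product C E U P p q"
    and h: "h \<in> hom C W E" and k: "k \<in> hom C T U"
  shows "prod_map C r s p q h k \<in> hom C R P"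
    and "\<lbrakk>x \<in> hom C V W; y \<in> hom C V T\<rbrakk>
      \<Longrightarrow> prod_map C r s p q h k \<cdot> pairing C r s x y = pairing C p q (h \<cdot> x) (k \<cdot> y)"
proof -
  have r: "r \<in> hom C R W" and s: "s \<in> hom C R T"
    using R unfolding is_product_def by auto
  note hr = comp_closed[OF r h] and ks = comp_closed[OF s k]
  show "prod_map C r s p q h k \<in> hom C R P"
    unfolding prod_map_def by (rule pairing_props[OF P hr ks])
  assume x: "x \<in> hom C V W" and y: "y \<in> hom C V T"
  note xy = pairing_props[OF R x y]
  show "prod_map C r s p q h k \<cdot> pairing C r s x y = pairing C p q (h \<cdot> x) (k \<cdot> y)"
    unfolding prod_map_def pairing_comp[OF P hr ks xy(1)]
    using xy comp_assoc[OF xy(1) r h] comp_assoc[OF xy(1) s k] by simp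
qed

lemma exponential_transpose:
  assumes "is_exponential C X T E P p q ev" "is_product C W T R r s" "f \<in> hom C R X"
  obtains h where "h \<in> hom C W E" "ev \<cdot> prod_map C r s p q h (ident C T) = f"
  using assms unfolding is_exponential_def by meson

lemma exponential_eqI:
  assumes exp: "is_exponential C X T E P p q ev" and R: "is_product C W T R r s"
    and h: "h \<in> hom C W E" and k: "k \<in> hom C W E"
    and eq: "ev \<cdot> prod_map C r s p q h (ident C T) = ev \<cdot> prod_map C r s p q k (ident C T)"
  shows "h = k"
proof -
  have P: "is_product C E T P p q" and ev: "ev \<in> hom C P X"
    using exp unfolding is_exponential_def by auto
  have T: "T \<in> obj C"
    using P hom_tgt_obj unfolding is_product_def by blast
  have "ev \<cdot> prod_map C r s p q k (ident C T) \<in> hom C R X"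
    by (rule comp_closed[OF prod_map_props(1)[OF R P k ident_closed[OF T]] ev])
  with exp R h k eq show ?thesis
    unfolding is_exponential_def by metis
qed

lemma coproduct_eqI:
  assumes "is_coproduct C X Y S i j" "h \<in> hom C S W" "k \<in> hom C S W" "h \<cdot> i = k \<cdot> i" "h \<cdot> j = k \<cdot> j"
  shows "h = k"
proof -
  have "k \<cdot> i \<in> hom C X W" "k \<cdot> j \<in> hom C Y W"
    using assms comp_closed unfolding is_coproduct_def by blast+
  then show ?thesis
    using assms unfolding is_coproduct_def by metis
qed

lemma coproduct_copair:
  assumes "is_coproduct C X Y S i j" "f \<in> hom C X W" "g \<in> hom C Y W"
  obtains h where "h \<in> hom C S W" "h \<cdot> i = f" "h \<cdot> j = g"
  using assms unfolding is_coproduct_def by meson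

text \<open>Presenting \<open>X\<close> itself as \<open>1 \<times> X\<close> makes the transpose of
  an arrow out of \<open>X\<close> a point of an exponential.\<close>

lemma product_terminal:
  assumes one: "is_terminal C one" and X: "X \<in> obj C"
  shows "is_product C one X X (bang C one X) (ident C X)"
  unfolding is_product_def
proof (intro conjI allI ballI)
  fix W f g assume f: "f \<in> hom C W one" and g: "g \<in> hom C W X"
  show "\<exists>!h. h \<in> hom C W X \<and> bang C one X \<cdot> h = f \<and> ident C X \<cdot> h = g"
  proof (rule ex1I[of _ g])
    show "g \<in> hom C W X \<and> bang C one X \<cdot> g = f \<and> ident C X \<cdot> g = g"
      using g f ident_comp comp_closed[OF g bang_in_hom[OF one X]] terminal_eq[OF one] by blast
  qed (use ident_comp in metis)
qed (use bang_in_hom[OF one X] ident_closed[OF X] in auto)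

lemma monicD:
  "\<lbrakk>monic C m; m \<in> hom C X Y; f \<in> hom C W X; g \<in> hom C W X; m \<cdot> f = m \<cdot> g\<rbrakk> \<Longrightarrow> f = g"
  unfolding monic_def by (auto simp: hom_def)

lemma monicI:
  assumes m: "m \<in> hom C X Y"
    and "\<And>W f g. \<lbrakk>f \<in> hom C W X; g \<in> hom C W X; m \<cdot> f = m \<cdot> g\<rbrakk> \<Longrightarrow> f = g"
  shows "monic C m"
proof -
  have "src C m = X" "m \<in> arr C"
    using m by (auto simp: hom_def)
  with assms(2) show ?thesis
    unfolding monic_def by blast
qed

lemma split_monic:
  assumes m: "m \<in> hom C X Y" and r: "r \<in> hom C Y X" and rm: "r \<cdot> m = ident C X"
  shows "monic C m"
proof (rule monicI[OF m])
  fix W f g assume fg: "f \<in> hom C W X" "g \<in> hom C W X" and eq: "m \<cdot> f = m \<cdot> g"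
  show "f = g"
    using comp_assoc[OF fg(1) m r] comp_assoc[OF fg(2) m r] eq rm
      ident_comp[OF fg(1)] ident_comp[OF fg(2)] by simp
qed

text \<open>Named objects \<open>X\<close>, \<open>Y\<close> replace the \<open>src\<close> terms of
  the definition, and uniqueness becomes joint monicity of the two legs.\<close>

lemma pullback_props:
  assumes pb: "is_pullback C f g P p q" and f: "f \<in> hom C X Z" and g: "g \<in> hom C Y Z"
  shows "p \<in> hom C P X" "q \<in> hom C P Y" "f \<cdot> p = g \<cdot> q"
    and "\<lbrakk>u \<in> hom C W X; v \<in> hom C W Y; f \<cdot> u = g \<cdot> v\<rbrakk>
      \<Longrightarrow> \<exists>h \<in> hom C W P. p \<cdot> h = u \<and> q \<cdot> h = v"
    and "\<lbrakk>h \<in> hom C W P; k \<in> hom C W P; p \<cdot> h = p \<cdot> k; q \<cdot> h = q \<cdot> k\<rbrakk> \<Longrightarrow> h = k"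
proof -
  have X: "src C f = X" and Y: "src C g = Y"
    using f g by (auto simp: hom_def)
  show p: "p \<in> hom C P X" and q: "q \<in> hom C P Y" and sq: "f \<cdot> p = g \<cdot> q"
    using pb X Y unfolding is_pullback_def by auto
  show "\<exists>h \<in> hom C W P. p \<cdot> h = u \<and> q \<cdot> h = v"
    if "u \<in> hom C W X" "v \<in> hom C W Y" "f \<cdot> u = g \<cdot> v"
    using pb X Y that unfolding is_pullback_def by blast
  show "h = k" if h: "h \<in> hom C W P" and k: "k \<in> hom C W P"
    and eq: "p \<cdot> h = p \<cdot> k" "q \<cdot> h = q \<cdot> k"
  proof -
    \<comment> \<open>The arrows \<open>p \<cdot> k\<close> and \<open>q \<cdot> k\<close> form a
      cone, and both \<open>h\<close> and \<open>k\<close> mediate it.\<close>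
    have "f \<cdot> (p \<cdot> k) = g \<cdot> (q \<cdot> k)"
      using comp_assoc[OF k p f] comp_assoc[OF k q g] sq by simp
    moreover have "p \<cdot> k \<in> hom C W X" "q \<cdot> k \<in> hom C W Y"
      using comp_closed k p q by blast+
    ultimately have "\<exists>!h. h \<in> hom C W P \<and> p \<cdot> h = p \<cdot> k \<and> q \<cdot> h = q \<cdot> k"
      using pb X Y unfolding is_pullback_def by blast
    then show ?thesis
      using h k eq by blast
  qed
qed

text \<open>\<open>L\<close> splits the idempotent \<open>h \<cdot> k\<close>, which fixes
  \<open>a\<close> and \<open>b\<close>. Since \<open>h\<close> is constantly \<open>a\<close> on
  one summand of \<open>Y\<close> and \<open>b\<close> on the other, arrows out of \<open>L\<close>
  correspond to arrows out of \<open>Y\<close> that are constant on each summand.\<close>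

lemma split_idempotent_coproduct:
  assumes S: "is_coproduct C B B' Y i j" and T: "is_terminal C one"
    and a: "a \<in> hom C one A" and b: "b \<in> hom C one A"
    and l: "l \<in> hom C one B" and l': "l' \<in> hom C one B'"
    and k: "k \<in> hom C A Y" and ka: "k \<cdot> a = i \<cdot> l" and kb: "k \<cdot> b = j \<cdot> l'"
    and m: "m \<in> hom C L A" and r: "r \<in> hom C A L" and rm: "r \<cdot> m = ident C L"
    and h: "h \<in> hom C Y A" and mr: "m \<cdot> r = h \<cdot> k"
    and hi: "h \<cdot> i = a \<cdot> bang C one B" and hj: "h \<cdot> j = b \<cdot> bang C one B'"
  shows "is_coproduct C one one L (r \<cdot> a) (r \<cdot> b)"
  unfolding is_coproduct_def
proof (intro conjI allI ballI)
  have i: "i \<in> hom C B Y" and j: "j \<in> hom C B' Y"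
    using S unfolding is_coproduct_def by auto
  have B: "B \<in> obj C" and B': "B' \<in> obj C"
    using i j hom_src_obj by auto
  note bB = bang_in_hom[OF T B] and bB' = bang_in_hom[OF T B']
  have bl: "bang C one B \<cdot> l = ident C one" "bang C one B' \<cdot> l' = ident C one"
    using terminal_eq[OF T] comp_closed[OF l bB] comp_closed[OF l' bB'] ident_closed hom_src_obj[OF l]
    by blast+
  show ra: "r \<cdot> a \<in> hom C one L" and rb: "r \<cdot> b \<in> hom C one L"
    using comp_closed a b r by blast+
  \<comment> \<open>The points \<open>l\<close>, \<open>l'\<close> place \<open>k \<cdot> a\<close>
    and \<open>k \<cdot> b\<close> in the two summands, where \<open>h\<close> is constant.\<close>
  have ha: "(h \<cdot> k) \<cdot> a = a"
    using comp_assoc[OF a k h] ka comp_assoc[OF l i h] hi comp_assoc[OF l bB a] bl comp_ident[OF a] by simp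
  have hb: "(h \<cdot> k) \<cdot> b = b"
    using comp_assoc[OF b k h] kb comp_assoc[OF l' j h] hj comp_assoc[OF l' bB' b] bl comp_ident[OF b] by simp
  have mra: "m \<cdot> (r \<cdot> a) = a" "m \<cdot> (r \<cdot> b) = b"
    using ha hb mr comp_assoc[OF a r m] comp_assoc[OF b r m] by simp_all
  fix W x y assume x: "x \<in> hom C one W" and y: "y \<in> hom C one W"
  \<comment> \<open>The arrow that is constantly \<open>x\<close> on \<open>B\<close> and
    \<open>y\<close> on \<open>B'\<close>; composing with \<open>k \<cdot> m\<close> carries it to
    \<open>L\<close>.\<close>
  obtain z where z: "z \<in> hom C Y W" "z \<cdot> i = x \<cdot> bang C one B" "z \<cdot> j = y \<cdot> bang C one B'"
    using coproduct_copair[OF S comp_closed[OF bB x] comp_closed[OF bB' y]] .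
  note km = comp_closed[OF m k]
  show "\<exists>!h. h \<in> hom C L W \<and> h \<cdot> (r \<cdot> a) = x \<and> h \<cdot> (r \<cdot> b) = y"
  proof (rule ex1I[of _ "z \<cdot> (k \<cdot> m)"], intro conjI)
    show "z \<cdot> (k \<cdot> m) \<in> hom C L W"
      by (rule comp_closed[OF km z(1)])
    show "(z \<cdot> (k \<cdot> m)) \<cdot> (r \<cdot> a) = x"
      using comp_assoc[OF ra km z(1)] comp_assoc[OF ra m k] mra ka comp_assoc[OF l i z(1)] z
        comp_assoc[OF l bB x] bl comp_ident[OF x] by simp
    show "(z \<cdot> (k \<cdot> m)) \<cdot> (r \<cdot> b) = y"
      using comp_assoc[OF rb km z(1)] comp_assoc[OF rb m k] mra kb comp_assoc[OF l' j z(1)] z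
        comp_assoc[OF l' bB' y] bl comp_ident[OF y] by simp
  next
    fix u assume "u \<in> hom C L W \<and> u \<cdot> (r \<cdot> a) = x \<and> u \<cdot> (r \<cdot> b) = y"
    then have u: "u \<in> hom C L W" and ua: "u \<cdot> (r \<cdot> a) = x" and ub: "u \<cdot> (r \<cdot> b) = y"
      by auto
    note ur = comp_closed[OF r u]
    note urh = comp_closed[OF h ur]
    \<comment> \<open>Both sides are constantly \<open>x\<close> on \<open>B\<close> and
      \<open>y\<close> on \<open>B'\<close>; from this \<open>u\<close> is recovered out of
      \<open>z\<close>.\<close>
    have "(u \<cdot> r) \<cdot> h = z"
    proof (rule coproduct_eqI[OF S urh z(1)])
      show "((u \<cdot> r) \<cdot> h) \<cdot> i = z \<cdot> i"
        using comp_assoc[OF i h ur] hi comp_assoc[OF bB a ur] comp_assoc[OF a r u] ua z by simp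
      show "((u \<cdot> r) \<cdot> h) \<cdot> j = z \<cdot> j"
        using comp_assoc[OF j h ur] hj comp_assoc[OF bB' b ur] comp_assoc[OF b r u] ub z by simp
    qed
    then have "z \<cdot> (k \<cdot> m) = (u \<cdot> r) \<cdot> (h \<cdot> (k \<cdot> m))"
      using comp_assoc[OF km h ur] by simp
    also have "\<dots> = (u \<cdot> r) \<cdot> (m \<cdot> (r \<cdot> m))"
      using comp_assoc[OF m k h] comp_assoc[OF m r m] mr by simp
    also have "\<dots> = u"
      using rm comp_ident[OF m] comp_assoc[OF m r u] comp_ident[OF u] by simp
    finally show "u = z \<cdot> (k \<cdot> m)" ..
  qed
qed

end

section \<open>Finite limits and splitting of idempotents\<close>

context topos
begin

text \<open>A pullback over the terminal object is a product, since its commutativity condition is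
  automatic.\<close>

lemma product_exists:
  assumes X: "X \<in> obj C" and Y: "Y \<in> obj C"
  obtains P p q where "is_product C X Y P p q"
proof -
  obtain one where one: "is_terminal C one"
    using has_terminal by blast
  note bX = bang_in_hom[OF one X] and bY = bang_in_hom[OF one Y]
  obtain P p q where pb: "is_pullback C (bang C one X) (bang C one Y) P p q"
    using has_pullbacks[of "bang C one X" "bang C one Y"] bX bY by (auto simp: hom_def)
  note pr = pullback_props[OF pb bX bY]
  have "is_product C X Y P p q"
    unfolding is_product_def
  proof (intro conjI allI ballI)
    fix W f g assume f: "f \<in> hom C W X" and g: "g \<in> hom C W Y"
    have "bang C one X \<cdot> f = bang C one Y \<cdot> g"
      using terminal_comp_bang[OF one f] terminal_comp_bang[OF one g] by simp
    then show "\<exists>!h. h \<in> hom C W P \<and> p \<cdot> h = f \<and> q \<cdot> h = g"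
      using pr(4)[OF f g] pr(5) by (metis (no_types, lifting))
  qed (use pr in auto)
  then show ?thesis ..
qed

text \<open>The equalizer is the pullback of the graphs \<open>\<langle>1, f\<rangle>\<close> and
  \<open>\<langle>1, g\<rangle>\<close>: projecting to \<open>X\<close> shows that its two legs
  coincide.\<close>

lemma equalizer_exists:
  assumes f: "f \<in> hom C X Z" and g: "g \<in> hom C X Z"
  obtains L m where "m \<in> hom C L X" "f \<cdot> m = g \<cdot> m"
    "\<And>W u. \<lbrakk>u \<in> hom C W X; f \<cdot> u = g \<cdot> u\<rbrakk> \<Longrightarrow> \<exists>h \<in> hom C W L. m \<cdot> h = u"
    "monic C m"
proof -
  have X: "X \<in> obj C" and Z: "Z \<in> obj C"
    using f hom_src_obj hom_tgt_obj by auto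
  note iX = ident_closed[OF X]
  obtain R r s where R: "is_product C X Z R r s"
    using product_exists[OF X Z] .
  have r: "r \<in> hom C R X" and s: "s \<in> hom C R Z"
    using R unfolding is_product_def by auto
  note pf = pairing_props[OF R iX f] and pg = pairing_props[OF R iX g]
  let ?f = "pairing C r s (ident C X) f" and ?g = "pairing C r s (ident C X) g"
  obtain L m n where pb: "is_pullback C ?f ?g L m n"
    using has_pullbacks[of ?f ?g] pf(1) pg(1) by (auto simp: hom_def)
  note pr = pullback_props[OF pb pf(1) pg(1)]
  have "ident C X \<cdot> m = ident C X \<cdot> n"
    using comp_assoc[OF pr(1) pf(1) r] comp_assoc[OF pr(2) pg(1) r] pf(2) pg(2) pr(3) by simp
  then have mn: "m = n"
    using ident_comp[OF pr(1)] ident_comp[OF pr(2)] by simp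
  show ?thesis
  proof
    show m: "m \<in> hom C L X"
      by (rule pr(1))
    show "f \<cdot> m = g \<cdot> m"
      using comp_assoc[OF pr(1) pf(1) s] comp_assoc[OF pr(2) pg(1) s] pf(3) pg(3) pr(3) mn by simp
    show "\<exists>h \<in> hom C W L. m \<cdot> h = u" if u: "u \<in> hom C W X" and eq: "f \<cdot> u = g \<cdot> u" for W u
    proof -
      have "?f \<cdot> u = ?g \<cdot> u"
        using pairing_comp[OF R iX f u] pairing_comp[OF R iX g u] eq by simp
      then show ?thesis
        using pr(4)[OF u u] by blast
    qed
    show "monic C m"
      using monicI[OF m] pr(5) mn by blast
  qed
qed

text \<open>The splitting is the equalizer of \<open>e\<close> and the identity: by idempotence
  \<open>e\<close> itself factors through it, which gives \<open>r\<close>.\<close>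

lemma idempotent_splits:
  assumes e: "e \<in> hom C X X" and idem: "e \<cdot> e = e"
  obtains L m r where "m \<in> hom C L X" "r \<in> hom C X L" "m \<cdot> r = e" "r \<cdot> m = ident C L"
proof -
  note X = hom_src_obj[OF e]
  note iX = ident_closed[OF X]
  obtain L m where m: "m \<in> hom C L X" and em: "e \<cdot> m = ident C X \<cdot> m" and mono: "monic C m"
    and univ: "\<And>W u. \<lbrakk>u \<in> hom C W X; e \<cdot> u = ident C X \<cdot> u\<rbrakk> \<Longrightarrow> \<exists>h \<in> hom C W L. m \<cdot> h = u"
    using equalizer_exists[OF e iX] by metis
  obtain r where r: "r \<in> hom C X L" and mr: "m \<cdot> r = e"
    using univ[OF e] idem ident_comp[OF e] by auto
  note L = hom_src_obj[OF m]
  have "m \<cdot> (r \<cdot> m) = m \<cdot> ident C L"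
    using comp_assoc[OF m r m] mr em ident_comp[OF m] comp_ident[OF m] by simp
  then have "r \<cdot> m = ident C L"
    using monicD[OF mono m comp_closed[OF m r] ident_closed[OF L]] by blast
  with m r mr show ?thesis ..
qed

section \<open>The subobject classifier on generalized elements\<close>

text \<open>If \<open>x\<close> and \<open>y\<close> send the same generalized elements to true,
  both pull \<open>t\<close> back to the same subobject \<open>N\<close>, and classifying arrows are
  unique.\<close>

lemma classifier_ext:
  assumes cl: "is_subobject_classifier C one \<Omega> t"
    and x: "x \<in> hom C W \<Omega>" and y: "y \<in> hom C W \<Omega>"
    and iff: "\<And>V w. w \<in> hom C V W \<Longrightarrow> x \<cdot> w = t \<cdot> bang C one V \<longleftrightarrow> y \<cdot> w = t \<cdot> bang C one V"
  shows "x = y"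
proof -
  have one: "is_terminal C one" and t: "t \<in> hom C one \<Omega>"
    using cl unfolding is_subobject_classifier_def by auto
  obtain N n b where pb: "is_pullback C x t N n b"
    using has_pullbacks[of x t] x t by (auto simp: hom_def)
  note pr = pullback_props[OF pb x t]
  note bN = bang_in_hom[OF one hom_src_obj[OF pr(1)]]
  have b: "b = bang C one N"
    by (rule terminal_eq[OF one pr(2) bN])
  have "monic C n"
  proof (rule monicI[OF pr(1)])
    fix V f g assume fg: "f \<in> hom C V N" "g \<in> hom C V N" and eq: "n \<cdot> f = n \<cdot> g"
    show "f = g"
      using pr(5)[OF fg eq] terminal_eq[OF one comp_closed[OF fg(1) pr(2)] comp_closed[OF fg(2) pr(2)]] by blast
  qed
  \<comment> \<open>A cone over \<open>y\<close> and \<open>t\<close> is an element that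
    \<open>y\<close>, hence also \<open>x\<close>, sends to true, so the square for \<open>x\<close>
    serves \<open>y\<close> as well.\<close>
  moreover have pby: "is_pullback C y t N n (bang C one N)"
    unfolding is_pullback_def
  proof (intro conjI allI ballI impI)
    show "y \<in> arr C" "t \<in> arr C" "tgt C y = tgt C t" "n \<in> hom C N (src C y)"
      "bang C one N \<in> hom C N (src C t)"
      using y t pr(1) bN by (auto simp: hom_def)
    show "y \<cdot> n = t \<cdot> bang C one N"
      using iff[OF pr(1)] pr(3) b by simp
    fix V u v assume "u \<in> hom C V (src C y)" "v \<in> hom C V (src C t)" and eq: "y \<cdot> u = t \<cdot> v"
    then have u: "u \<in> hom C V W" and v: "v \<in> hom C V one"
      using y t by (auto simp: hom_def)
    have vb: "v = bang C one V"
      by (rule terminal_eq[OF one v bang_in_hom[OF one hom_src_obj[OF u]]])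
    then have "x \<cdot> u = t \<cdot> v"
      using iff[OF u] eq by simp
    from pr(4)[OF u v this] obtain h where "h \<in> hom C V N" "n \<cdot> h = u" "b \<cdot> h = v" by blast
    then show "\<exists>!h. h \<in> hom C V N \<and> n \<cdot> h = u \<and> bang C one N \<cdot> h = v"
      using pr(5) b by metis
  qed
  moreover have "src C n = N" "tgt C n = W"
    using pr(1) by (auto simp: hom_def)
  ultimately show ?thesis
    using cl pb x y unfolding is_subobject_classifier_def b by metis
qed

text \<open>Turns the classifying square into a membership test for generalized elements, the form
  in which \<open>classifier_ext\<close> compares arrows.\<close>

lemma classifying_arrow:
  assumes cl: "is_subobject_classifier C one \<Omega> t" and m: "m \<in> hom C X Y" and mono: "monic C m"
  obtains c where "c \<in> hom C Y \<Omega>"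
    "\<And>V w. w \<in> hom C V Y \<Longrightarrow> c \<cdot> w = t \<cdot> bang C one V \<longleftrightarrow> (\<exists>x \<in> hom C V X. m \<cdot> x = w)"
proof -
  have one: "is_terminal C one" and t: "t \<in> hom C one \<Omega>"
    using cl unfolding is_subobject_classifier_def by auto
  have src: "src C m = X" "tgt C m = Y"
    using m by (auto simp: hom_def)
  obtain c where c: "c \<in> hom C Y \<Omega>" and pb: "is_pullback C c t X m (bang C one X)"
    using cl mono src unfolding is_subobject_classifier_def by metis
  note pr = pullback_props[OF pb c t]
  show ?thesis
  proof (rule that[OF c])
    fix V w assume w: "w \<in> hom C V Y"
    note bV = bang_in_hom[OF one hom_src_obj[OF w]]
    show "c \<cdot> w = t \<cdot> bang C one V \<longleftrightarrow> (\<exists>x \<in> hom C V X. m \<cdot> x = w)"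
    proof
      assume "c \<cdot> w = t \<cdot> bang C one V"
      then show "\<exists>x \<in> hom C V X. m \<cdot> x = w"
        using pr(4)[OF w bV] by blast
    next
      assume "\<exists>x \<in> hom C V X. m \<cdot> x = w"
      then obtain x where x: "x \<in> hom C V X" "m \<cdot> x = w" by blast
      then show "c \<cdot> w = t \<cdot> bang C one V"
        using comp_assoc[OF x(1) m c] comp_assoc[OF x(1) pr(2) t] pr(3)
          terminal_comp_bang[OF one x(1)] by simp
    qed
  qed
qed

section \<open>Coproduct decompositions without stability under pullback\<close>

text \<open>Transposing to \<open>Y \<rightarrow> Z\<^sup>X\<close> shows that \<open>- \<times> X\<close> preserves the joint epimorphy of coproduct injections.\<close>

lemma coproduct_product_eqI:
  assumes S: "is_coproduct C B B' Y b b'" and R: "is_product C Y X R r s"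
    and f: "f \<in> hom C R Z" and g: "g \<in> hom C R Z"
    and eq: "\<And>V u x. \<lbrakk>u \<in> hom C V B; x \<in> hom C V X\<rbrakk>
      \<Longrightarrow> f \<cdot> pairing C r s (b \<cdot> u) x = g \<cdot> pairing C r s (b \<cdot> u) x"
    and eq': "\<And>V u x. \<lbrakk>u \<in> hom C V B'; x \<in> hom C V X\<rbrakk>
      \<Longrightarrow> f \<cdot> pairing C r s (b' \<cdot> u) x = g \<cdot> pairing C r s (b' \<cdot> u) x"
  shows "f = g"
proof -
  have b: "b \<in> hom C B Y" and b': "b' \<in> hom C B' Y"
    using S unfolding is_coproduct_def by auto
  have r: "r \<in> hom C R Y" and s: "s \<in> hom C R X"
    using R unfolding is_product_def by auto
  have X: "X \<in> obj C" and Z: "Z \<in> obj C"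
    using s f hom_tgt_obj by auto
  note iX = ident_closed[OF X]
  obtain E P p q ev where exp: "is_exponential C Z X E P p q ev"
    using has_exponentials[OF Z X] by blast
  have P: "is_product C E X P p q" and ev: "ev \<in> hom C P Z"
    using exp unfolding is_exponential_def by auto
  obtain h where h: "h \<in> hom C Y E" and hf: "ev \<cdot> prod_map C r s p q h (ident C X) = f"
    using exponential_transpose[OF exp R f] .
  obtain k where k: "k \<in> hom C Y E" and kg: "ev \<cdot> prod_map C r s p q k (ident C X) = g"
    using exponential_transpose[OF exp R g] .
  \<comment> \<open>Over the product \<open>Q\<close> of \<open>D\<close> and \<open>X\<close>, the
    transposes of \<open>h \<cdot> c\<close> and \<open>k \<cdot> c\<close> are \<open>f\<close> and
    \<open>g\<close> at the generic element \<open>(c \<cdot> u, v)\<close>.\<close>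
  have agree: "h \<cdot> c = k \<cdot> c"
    if c: "c \<in> hom C D Y" and eqc: "\<And>V u x. \<lbrakk>u \<in> hom C V D; x \<in> hom C V X\<rbrakk>
      \<Longrightarrow> f \<cdot> pairing C r s (c \<cdot> u) x = g \<cdot> pairing C r s (c \<cdot> u) x" for c D
  proof -
    obtain Q u v where Q: "is_product C D X Q u v"
      using product_exists[OF hom_src_obj[OF c] X] .
    have u: "u \<in> hom C Q D" and v: "v \<in> hom C Q X"
      using Q unfolding is_product_def by auto
    note cu = comp_closed[OF u c]
    note w = pairing_props(1)[OF R cu v]
    \<comment> \<open>Naturality of transposition in the parameter object.\<close>
    have tr: "ev \<cdot> prod_map C u v p q (z \<cdot> c) (ident C X)
        = (ev \<cdot> prod_map C r s p q z (ident C X)) \<cdot> pairing C r s (c \<cdot> u) v"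
      if z: "z \<in> hom C Y E" for z
      using prod_map_props[OF R P z iX] comp_assoc[OF w prod_map_props(1)[OF R P z iX] ev]
        cu v comp_assoc[OF u c z]
      unfolding prod_map_def[of C u v] by simp
    show ?thesis
      using exponential_eqI[OF exp Q comp_closed[OF c h] comp_closed[OF c k]]
        tr[OF h] tr[OF k] hf kg eqc[OF u v] by simp
  qed
  have "h \<cdot> b = k \<cdot> b" "h \<cdot> b' = k \<cdot> b'"
    by (rule agree[OF b], erule (1) eq) (rule agree[OF b'], erule (1) eq')
  then have "h = k"
    by (rule coproduct_eqI[OF S h k])
  then show ?thesis
    using hf kg by simp
qed

text \<open>
  The graph of \<open>h\<close> and its intersection with \<open>B \<times> X\<close> have the same classifying arrow, because
  the classifying arrows agree on \<open>B \<times> X\<close> and on \<open>B' \<times> X\<close>. This avoids the stability of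
  coproducts under pullback.
\<close>

lemma factors_through_summand:
  assumes S: "is_coproduct C B B' Y b b'" and mono: "monic C b"
    and h: "h \<in> hom C X Y"
    and pb': "is_pullback C h b' D' d' e'" and init: "is_initial C D'"
  obtains k where "k \<in> hom C X B" "b \<cdot> k = h"
proof -
  have b: "b \<in> hom C B Y" and b': "b' \<in> hom C B' Y"
    using S unfolding is_coproduct_def by auto
  have X: "X \<in> obj C" and Y: "Y \<in> obj C"
    using h hom_src_obj hom_tgt_obj by auto
  note iX = ident_closed[OF X]
  obtain R r s where R: "is_product C Y X R r s"
    using product_exists[OF Y X] .
  have r: "r \<in> hom C R Y" and s: "s \<in> hom C R X"
    using R unfolding is_product_def by auto
  obtain one \<Omega> t where cl: "is_subobject_classifier C one \<Omega> t"
    using has_subobject_classifier by blast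
  obtain D d e where pb: "is_pullback C h b D d e"
    using has_pullbacks[of h b] h b by (auto simp: hom_def)
  note pr = pullback_props[OF pb h b] and pr' = pullback_props[OF pb' h b']
  \<comment> \<open>The graph of \<open>h\<close>, a monic split by the second projection.\<close>
  define m where "m = pairing C r s h (ident C X)"
  note m = pairing_props[OF R h iX, folded m_def]
  have monom: "monic C m"
    by (rule split_monic[OF m(1) s m(3)])
  note md = comp_closed[OF pr(1) m(1)]
  \<comment> \<open>The leg \<open>d\<close> inherits monicity from \<open>b\<close>.\<close>
  have monomd: "monic C (m \<cdot> d)"
  proof (rule monicI[OF md])
    fix V f g assume fg: "f \<in> hom C V D" "g \<in> hom C V D" and eq: "(m \<cdot> d) \<cdot> f = (m \<cdot> d) \<cdot> g"
    have "d \<cdot> f = d \<cdot> g"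
      using monicD[OF monom m(1) comp_closed[OF fg(1) pr(1)] comp_closed[OF fg(2) pr(1)]]
        comp_assoc[OF fg(1) pr(1) m(1)] comp_assoc[OF fg(2) pr(1) m(1)] eq by simp
    moreover from this have "b \<cdot> (e \<cdot> f) = b \<cdot> (e \<cdot> g)"
      using comp_assoc[OF fg(1) pr(2) b] comp_assoc[OF fg(2) pr(2) b]
        comp_assoc[OF fg(1) pr(1) h] comp_assoc[OF fg(2) pr(1) h] pr(3) by simp
    then have "e \<cdot> f = e \<cdot> g"
      using monicD[OF mono b comp_closed[OF fg(1) pr(2)] comp_closed[OF fg(2) pr(2)]] by simp
    ultimately show "f = g"
      using pr(5)[OF fg] by simp
  qed
  obtain c where c: "c \<in> hom C R \<Omega>" and c_iff:
    "\<And>V w. w \<in> hom C V R \<Longrightarrow> c \<cdot> w = t \<cdot> bang C one V \<longleftrightarrow> (\<exists>x \<in> hom C V X. m \<cdot> x = w)"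
    using classifying_arrow[OF cl m(1) monom] by metis
  obtain c' where c': "c' \<in> hom C R \<Omega>" and c'_iff:
    "\<And>V w. w \<in> hom C V R \<Longrightarrow> c' \<cdot> w = t \<cdot> bang C one V \<longleftrightarrow> (\<exists>x \<in> hom C V D. (m \<cdot> d) \<cdot> x = w)"
    using classifying_arrow[OF cl md monomd] by metis
  \<comment> \<open>By \<open>fac\<close>, any element of \<open>X\<close> that \<open>h\<close>
    sends into the image of \<open>a\<close> factors through \<open>d\<close>; hence over
    \<open>a\<close> the graph and its part over \<open>D\<close> have the same elements.\<close>
  have agree: "c \<cdot> pairing C r s (a \<cdot> u) x = c' \<cdot> pairing C r s (a \<cdot> u) x"
    if a: "a \<in> hom C G Y" and u: "u \<in> hom C V G" and x: "x \<in> hom C V X"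
      and fac: "\<And>U v z. \<lbrakk>v \<in> hom C U G; z \<in> hom C U X; h \<cdot> z = a \<cdot> v\<rbrakk> \<Longrightarrow> \<exists>y \<in> hom C U D. d \<cdot> y = z"
    for a G V u x
  proof -
    note au = comp_closed[OF u a]
    note w = pairing_props(1)[OF R au x]
    show ?thesis
    proof (rule classifier_ext[OF cl comp_closed[OF w c] comp_closed[OF w c']])
      fix U v assume v: "v \<in> hom C U V"
      note wv = comp_closed[OF v w]
      have "(\<exists>z \<in> hom C U X. m \<cdot> z = pairing C r s (a \<cdot> u) x \<cdot> v)
        \<longleftrightarrow> (\<exists>z \<in> hom C U D. (m \<cdot> d) \<cdot> z = pairing C r s (a \<cdot> u) x \<cdot> v)"
      proof
        assume "\<exists>z \<in> hom C U X. m \<cdot> z = pairing C r s (a \<cdot> u) x \<cdot> v"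
        then obtain z where z: "z \<in> hom C U X" and mz: "m \<cdot> z = pairing C r s (a \<cdot> u) x \<cdot> v" by blast
        have "r \<cdot> (m \<cdot> z) = (a \<cdot> u) \<cdot> v"
          using comp_assoc[OF v w r] pairing_props(2)[OF R au x] mz by simp
        then have "h \<cdot> z = a \<cdot> (u \<cdot> v)"
          using comp_assoc[OF z m(1) r] m(2) comp_assoc[OF v u a] by simp
        from fac[OF comp_closed[OF v u] z this] obtain y where "y \<in> hom C U D" "d \<cdot> y = z" by blast
        then show "\<exists>z \<in> hom C U D. (m \<cdot> d) \<cdot> z = pairing C r s (a \<cdot> u) x \<cdot> v"
          using comp_assoc[OF _ pr(1) m(1)] mz by metis
      next
        assume "\<exists>z \<in> hom C U D. (m \<cdot> d) \<cdot> z = pairing C r s (a \<cdot> u) x \<cdot> v"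
        then show "\<exists>z \<in> hom C U X. m \<cdot> z = pairing C r s (a \<cdot> u) x \<cdot> v"
          using comp_assoc[OF _ pr(1) m(1)] comp_closed[OF _ pr(1)] by metis
      qed
      then show "(c \<cdot> pairing C r s (a \<cdot> u) x) \<cdot> v = t \<cdot> bang C one U
        \<longleftrightarrow> (c' \<cdot> pairing C r s (a \<cdot> u) x) \<cdot> v = t \<cdot> bang C one U"
        using c_iff[OF wv] c'_iff[OF wv] comp_assoc[OF v w c] comp_assoc[OF v w c'] by simp
    qed
  qed
  have fac_b: "\<exists>y \<in> hom C U D. d \<cdot> y = z"
    if "v \<in> hom C U B" "z \<in> hom C U X" "h \<cdot> z = b \<cdot> v" for U v z
    using pr(4)[OF that(2,1,3)] by blast
  \<comment> \<open>Such elements factor through the initial \<open>D'\<close>, and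
    \<open>D'\<close> maps to \<open>D\<close> over \<open>X\<close>.\<close>
  have fac_b': "\<exists>y \<in> hom C U D. d \<cdot> y = z"
    if v: "v \<in> hom C U B'" and z: "z \<in> hom C U X" and eq: "h \<cdot> z = b' \<cdot> v" for U v z
  proof -
    obtain n where n: "n \<in> hom C U D'" "d' \<cdot> n = z"
      using pr'(4)[OF z v eq] by blast
    obtain i where i: "i \<in> hom C D' D"
      using init hom_src_obj[OF pr(1)] unfolding is_initial_def by blast
    have "d \<cdot> i = d'"
      by (rule initial_eq[OF init comp_closed[OF i pr(1)] pr'(1)])
    then show ?thesis
      using comp_assoc[OF n(1) i pr(1)] n comp_closed[OF n(1) i] by (metis (no_types))
  qed
  have "c = c'"
    by (rule coproduct_product_eqI[OF S R c c' agree[OF b _ _ fac_b] agree[OF b' _ _ fac_b']])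
  \<comment> \<open>Taken at the generic element \<open>m\<close> of the graph, equality of the two
    subobjects gives a section \<open>k\<close> of \<open>d\<close>.\<close>
  moreover have "c \<cdot> m = t \<cdot> bang C one X"
    using c_iff[OF m(1)] iX comp_ident[OF m(1)] by blast
  ultimately obtain k where k: "k \<in> hom C X D" and mk: "(m \<cdot> d) \<cdot> k = m"
    using c'_iff[OF m(1)] by blast
  have "d \<cdot> k = ident C X"
    using comp_assoc[OF k pr(1) m(1)] mk comp_ident[OF m(1)]
      monicD[OF monom m(1) comp_closed[OF k pr(1)] iX] by simp
  then have "b \<cdot> (e \<cdot> k) = h"
    using comp_assoc[OF k pr(2) b] comp_assoc[OF k pr(1) h] pr(3) comp_ident[OF h] by simp
  then show ?thesis
    using that[OF comp_closed[OF k pr(2)]] by blast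
qed

section \<open>Points, decidable objects and connected objects\<close>

lemma arrows_eq_of_points_eq:
  assumes one: "is_terminal C one" and f: "f \<in> hom C X Z" and g: "g \<in> hom C X Z"
    and pts: "\<And>W x y. \<lbrakk>x \<in> hom C one W; y \<in> hom C one W\<rbrakk> \<Longrightarrow> x = y"
  shows "f = g"
proof -
  have X: "X \<in> obj C" and Z: "Z \<in> obj C"
    using f hom_src_obj hom_tgt_obj by auto
  obtain E P p q ev where exp: "is_exponential C Z X E P p q ev"
    using has_exponentials[OF Z X] by blast
  note R = product_terminal[OF one X]
  obtain h where "h \<in> hom C one E" "ev \<cdot> prod_map C (bang C one X) (ident C X) p q h (ident C X) = f"
    using exponential_transpose[OF exp R f] .
  moreover obtain k where "k \<in> hom C one E" "ev \<cdot> prod_map C (bang C one X) (ident C X) p q k (ident C X) = g"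
    using exponential_transpose[OF exp R g] .
  ultimately show ?thesis
    using pts by metis
qed

lemma decidable_diagonal:
  assumes "decidable C A"
  obtains Y u v A' m where "is_product C A A Y u v"
    "monic C (pairing C u v (ident C A) (ident C A))"
    "is_coproduct C A A' Y (pairing C u v (ident C A) (ident C A)) m"
proof -
  obtain Y u v where Y: "is_product C A A Y u v"
    and co: "is_complemented C (pairing C u v (ident C A) (ident C A))" and A: "A \<in> obj C"
    using assms unfolding decidable_def by blast
  have "src C (pairing C u v (ident C A) (ident C A)) = A"
    "tgt C (pairing C u v (ident C A) (ident C A)) = Y"
    using pairing_props(1)[OF Y ident_closed[OF A] ident_closed[OF A]] by (auto simp: hom_def)
  then show ?thesis
    using that[OF Y] co unfolding is_complemented_def by auto
qed

text \<open>
  With \<open>y = \<langle>a, b\<rangle>\<close> off the diagonal, let \<open>h : A \<times> A \<rightarrow> A\<close> be \<open>a\<close> on the diagonal and \<open>b\<close> off it.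
  Then \<open>e = h(a, -)\<close> satisfies \<open>e \<cdot> h = h\<close>, so it is idempotent, and its splitting is
  the subobject \<open>{a, b}\<close> of \<open>A\<close>, a coproduct \<open>1 + 1\<close>.
\<close>

lemma off_diagonal_point_imp_coproduct:
  assumes Y: "is_product C A A Y u v"
    and S: "is_coproduct C A A' Y (pairing C u v (ident C A) (ident C A)) m"
    and one: "is_terminal C one" and y: "y \<in> hom C one A'"
  obtains L i j where "is_coproduct C one one L i j"
proof -
  let ?\<Delta> = "pairing C u v (ident C A) (ident C A)"
  have u: "u \<in> hom C Y A" and v: "v \<in> hom C Y A"
    using Y unfolding is_product_def by auto
  have m: "m \<in> hom C A' Y"
    using S unfolding is_coproduct_def by auto
  have A: "A \<in> obj C" and A': "A' \<in> obj C"
    using u hom_tgt_obj y by auto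
  note iA = ident_closed[OF A]
  note \<Delta> = pairing_props(1)[OF Y iA iA]
  note my = comp_closed[OF y m]
  define a b where "a = u \<cdot> (m \<cdot> y)" and "b = v \<cdot> (m \<cdot> y)"
  have a: "a \<in> hom C one A" and b: "b \<in> hom C one A"
    unfolding a_def b_def using comp_closed my u v by blast+
  note bA = bang_in_hom[OF one A] and bA' = bang_in_hom[OF one A']
  note abA = comp_closed[OF bA a] and bbA' = comp_closed[OF bA' b]
  \<comment> \<open>This is \<open>x \<mapsto> (a, x)\<close>, so \<open>h \<cdot> k\<close> is
    \<open>h(a, -)\<close>; it sends \<open>a\<close> to the diagonal and \<open>b\<close> to the
    given point off it.\<close>
  define k where "k = pairing C u v (a \<cdot> bang C one A) (ident C A)"
  note k = pairing_props(1)[OF Y abA iA, folded k_def]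
  have k_pt: "k \<cdot> x = pairing C u v a x" if x: "x \<in> hom C one A" for x
  proof -
    have "bang C one A \<cdot> x = ident C one"
      using terminal_eq[OF one comp_closed[OF x bA] ident_closed] hom_src_obj[OF x] by blast
    then show ?thesis
      unfolding k_def pairing_comp[OF Y abA iA x]
      using comp_assoc[OF x bA a] comp_ident[OF a] ident_comp[OF x] by simp
  qed
  have ka: "k \<cdot> a = ?\<Delta> \<cdot> a"
    using k_pt[OF a] pairing_comp[OF Y iA iA a] ident_comp[OF a] by simp
  have kb: "k \<cdot> b = m \<cdot> y"
    using k_pt[OF b] pairing_eta[OF Y my] unfolding a_def b_def by simp
  obtain h where h: "h \<in> hom C Y A" and h\<Delta>: "h \<cdot> ?\<Delta> = a \<cdot> bang C one A"
    and hm: "h \<cdot> m = b \<cdot> bang C one A'"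
    using coproduct_copair[OF S abA bbA'] .
  note e = comp_closed[OF k h]
  have bang_a: "bang C one A \<cdot> a = ident C one" and bang_y: "bang C one A' \<cdot> y = ident C one"
    using terminal_eq[OF one _ ident_closed[OF hom_src_obj[OF a]]] comp_closed[OF a bA] comp_closed[OF y bA']
    by blast+
  have ea: "(h \<cdot> k) \<cdot> a = a"
    using comp_assoc[OF a k h] ka comp_assoc[OF a \<Delta> h] h\<Delta> comp_assoc[OF a bA a] bang_a comp_ident[OF a] by simp
  have eb: "(h \<cdot> k) \<cdot> b = b"
    using comp_assoc[OF b k h] kb comp_assoc[OF y m h] hm comp_assoc[OF y bA' b] bang_y comp_ident[OF b] by simp
  \<comment> \<open>On each summand \<open>h\<close> is constantly \<open>a\<close> or
    \<open>b\<close>, and \<open>h \<cdot> k\<close> fixes both points.\<close>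
  have eh: "(h \<cdot> k) \<cdot> h = h"
    using comp_assoc[OF \<Delta> h e] comp_assoc[OF m h e] h\<Delta> hm
      comp_assoc[OF bA a e] comp_assoc[OF bA' b e] ea eb
    by (intro coproduct_eqI[OF S comp_closed[OF h e] h]) simp_all
  then have idem: "(h \<cdot> k) \<cdot> (h \<cdot> k) = h \<cdot> k"
    using comp_assoc[OF k h e] by simp
  obtain L n r where n: "n \<in> hom C L A" and r: "r \<in> hom C A L"
    and nr: "n \<cdot> r = h \<cdot> k" and rn: "r \<cdot> n = ident C L"
    using idempotent_splits[OF e idem] .
  from that[OF split_idempotent_coproduct[OF S one a b a y k ka kb n r rn h nr h\<Delta> hm]]
  show ?thesis .
qed

text \<open>\<open>f\<close> factors through a minimal decidable object of \<open>T\<close>; that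
  object is terminal up to isomorphism, so it cannot separate \<open>x\<close> and
  \<open>y\<close>.\<close>

lemma connected_constant:
  assumes conn: "connected C T" and one: "is_terminal C one"
    and S: "is_coproduct C one one S i j" and f: "f \<in> hom C T S"
    and x: "x \<in> hom C one T" and y: "y \<in> hom C one T"
  shows "f \<cdot> x = f \<cdot> y"
proof -
  obtain P p one' where min: "minimal_decidable C T P p" and one': "is_terminal C one'"
    and iso: "isomorphic C P one'"
    using conn unfolding connected_def by blast
  have p: "p \<in> hom C T P"
    using min unfolding minimal_decidable_def by auto
  obtain g where g: "g \<in> hom C P S" and gp: "g \<cdot> p = f"
    using min one S f unfolding minimal_decidable_def by metis
  obtain z w where z: "z \<in> hom C P one'" and w: "w \<in> hom C one' P" and wz: "w \<cdot> z = ident C P"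
    using iso unfolding isomorphic_def is_iso_def by (auto simp: hom_def)
  note px = comp_closed[OF x p] and py = comp_closed[OF y p]
  have "z \<cdot> (p \<cdot> x) = z \<cdot> (p \<cdot> y)"
    by (rule terminal_eq[OF one' comp_closed[OF px z] comp_closed[OF py z]])
  then have "p \<cdot> x = p \<cdot> y"
    using comp_assoc[OF px z w] comp_assoc[OF py z w] wz ident_comp[OF px] ident_comp[OF py] by simp
  then show ?thesis
    using comp_assoc[OF x p g] comp_assoc[OF y p g] gp by simp
qed

text \<open>The first claim of the argument, for any \<open>f\<close> in place of \<open>ev\<close>:
  \<open>E\<close> is a mere parameter, frozen at a point when connectedness is applied.\<close>

lemma connected_parameter_constant:
  assumes NS: "NS C" and conn: "connected C T"
    and one: "is_terminal C one" and t0: "t0 \<in> hom C one T" and dec: "decidable C A"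
    and P: "is_product C E T P p q" and f: "f \<in> hom C P A"
  shows "f \<cdot> pairing C p q p (t0 \<cdot> bang C one P) = f"
proof -
  obtain Y u v A' m where Y: "is_product C A A Y u v"
    and mono: "monic C (pairing C u v (ident C A) (ident C A))"
    and S: "is_coproduct C A A' Y (pairing C u v (ident C A) (ident C A)) m"
    using decidable_diagonal[OF dec] .
  let ?\<Delta> = "pairing C u v (ident C A) (ident C A)"
  have u: "u \<in> hom C Y A" and v: "v \<in> hom C Y A"
    using Y unfolding is_product_def by auto
  have p: "p \<in> hom C P E" and q: "q \<in> hom C P T"
    using P unfolding is_product_def by auto
  have m: "m \<in> hom C A' Y"
    using S unfolding is_coproduct_def by auto
  note A = hom_tgt_obj[OF u]
  note iA = ident_closed[OF A]
  note \<Delta> = pairing_props[OF Y iA iA]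
  note bP = bang_in_hom[OF one product_obj[OF P]]
  note oP = comp_closed[OF bP t0]
  \<comment> \<open>Resets the second coordinate: \<open>(w, t) \<mapsto> (w, t0)\<close>.\<close>
  define c where "c = pairing C p q p (t0 \<cdot> bang C one P)"
  note c = pairing_props[OF P p oP, folded c_def]
  note fc = comp_closed[OF c(1) f]
  define h where "h = pairing C u v f (f \<cdot> c)"
  note h = pairing_props[OF Y f fc, folded h_def]
  have "f = f \<cdot> c"
  proof -
    obtain D d e where pb: "is_pullback C h m D d e"
      using has_pullbacks[of h m] h m by (auto simp: hom_def)
    note pr = pullback_props[OF pb h(1) m]
    show ?thesis
    proof (cases "is_initial C D")
      case True
      obtain k where k: "k \<in> hom C P A" and "?\<Delta> \<cdot> k = h"
        using factors_through_summand[OF S mono h(1) pb True] .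
      then have "u \<cdot> h = k" "v \<cdot> h = k"
        using comp_assoc[OF k \<Delta>(1) u] comp_assoc[OF k \<Delta>(1) v] \<Delta> ident_comp[OF k] by simp_all
      then show ?thesis
        using h by simp
    next
      case False
      then obtain one' x' where "is_terminal C one'" and x': "x' \<in> hom C one' D"
        using NS hom_src_obj[OF pr(1)] unfolding NS_def by blast
      \<comment> \<open>NS may supply its point on another terminal object; \<open>z\<close> moves
        it to \<open>one\<close>.\<close>
      then obtain z where z: "z \<in> hom C one one'"
        using hom_src_obj[OF t0] unfolding is_terminal_def by blast
      define x where "x = x' \<cdot> z"
      have x: "x \<in> hom C one D"
        unfolding x_def by (rule comp_closed[OF z x'])
      note ex = comp_closed[OF x pr(2)] and dx = comp_closed[OF x pr(1)]
      obtain L i j where L: "is_coproduct C one one L i j"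
        using off_diagonal_point_imp_coproduct[OF Y S one ex] .
      have i: "i \<in> hom C one L" and j: "j \<in> hom C one L"
        using L unfolding is_coproduct_def by auto
      note T = hom_tgt_obj[OF t0]
      note A' = hom_src_obj[OF m]
      note bA = bang_in_hom[OF one A] and bA' = bang_in_hom[OF one A'] and bT = bang_in_hom[OF one T]
      \<comment> \<open>\<open>g\<close> decides equality on \<open>A\<close>: it is
        \<open>i\<close> on the diagonal and \<open>j\<close> off it.\<close>
      obtain g where g: "g \<in> hom C Y L" and g\<Delta>: "g \<cdot> ?\<Delta> = i \<cdot> bang C one A"
        and gm: "g \<cdot> m = j \<cdot> bang C one A'"
        using coproduct_copair[OF S comp_closed[OF bA i] comp_closed[OF bA' j]] .
      have pt: "bang C one Z \<cdot> y = ident C one" if "y \<in> hom C one Z" for y Z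
        using terminal_comp_bang[OF one that] terminal_eq[OF one] bang_in_hom[OF one] ident_closed
          hom_src_obj[OF that] by metis
      define w where "w = p \<cdot> (d \<cdot> x)"
      have w: "w \<in> hom C one E"
        unfolding w_def by (rule comp_closed[OF dx p])
      define t where "t = q \<cdot> (d \<cdot> x)"
      have t: "t \<in> hom C one T"
        unfolding t_def by (rule comp_closed[OF dx q])
      note wT = comp_closed[OF bT w] and iT = ident_closed[OF T]
      \<comment> \<open>The slice of \<open>E \<times> T\<close> at the first coordinate
        \<open>w\<close> of the point \<open>d \<cdot> x\<close>.\<close>
      define s where "s = pairing C p q (w \<cdot> bang C one T) (ident C T)"
      note s = pairing_props[OF P wT iT, folded s_def]
      have s_pt: "s \<cdot> y = pairing C p q w y" if y: "y \<in> hom C one T" for y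
        unfolding s_def pairing_comp[OF P wT iT y]
        using comp_assoc[OF y bT w] pt[OF y] comp_ident[OF w] ident_comp[OF y] by simp
      have st: "s \<cdot> t = d \<cdot> x"
        using s_pt[OF t] pairing_eta[OF P dx] unfolding w_def t_def by simp
      note so = comp_closed[OF t0 s(1)]
      \<comment> \<open>The point \<open>(w, t0)\<close> is fixed by \<open>c\<close>, so at
        \<open>t0\<close> the arrow \<open>h \<cdot> s\<close> lands on the diagonal.\<close>
      have "c \<cdot> (s \<cdot> t0) = pairing C p q (p \<cdot> (s \<cdot> t0)) ((t0 \<cdot> bang C one P) \<cdot> (s \<cdot> t0))"
        unfolding c_def by (rule pairing_comp[OF P p oP so])
      also have "(t0 \<cdot> bang C one P) \<cdot> (s \<cdot> t0) = t0"
        using comp_assoc[OF so bP t0] pt[OF so] comp_ident[OF t0] by simp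
      also have "t0 = q \<cdot> (s \<cdot> t0)"
        using s_pt[OF t0] pairing_props(3)[OF P w t0] by simp
      finally have cso: "c \<cdot> (s \<cdot> t0) = s \<cdot> t0"
        using pairing_eta[OF P so] \<open>t0 = q \<cdot> (s \<cdot> t0)\<close> by simp
      note fso = comp_closed[OF so f]
      have "h \<cdot> (s \<cdot> t0) = ?\<Delta> \<cdot> (f \<cdot> (s \<cdot> t0))"
        unfolding h_def pairing_comp[OF Y f fc so] pairing_comp[OF Y iA iA fso]
        using comp_assoc[OF so c(1) f] cso ident_comp[OF fso] by simp
      then have "g \<cdot> (h \<cdot> (s \<cdot> t0)) = i"
        using comp_assoc[OF fso \<Delta>(1) g] g\<Delta> comp_assoc[OF fso bA i] pt[OF fso] comp_ident[OF i] by simp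
      \<comment> \<open>At \<open>t\<close> the slice passes through \<open>d \<cdot> x\<close>,
        which \<open>h\<close> sends off the diagonal.\<close>
      moreover have "h \<cdot> (s \<cdot> t) = m \<cdot> (e \<cdot> x)"
        using st comp_assoc[OF x pr(1) h(1)] comp_assoc[OF x pr(2) m] pr(3) by simp
      then have "g \<cdot> (h \<cdot> (s \<cdot> t)) = j"
        using comp_assoc[OF ex m g] gm comp_assoc[OF ex bA' j] pt[OF ex] comp_ident[OF j] by simp
      moreover note hs = comp_closed[OF s(1) h(1)]
      have "(g \<cdot> (h \<cdot> s)) \<cdot> t0 = (g \<cdot> (h \<cdot> s)) \<cdot> t"
        by (rule connected_constant[OF conn one L comp_closed[OF hs g] t0 t])
      ultimately have "i = j"
        using comp_assoc[OF t0 hs g] comp_assoc[OF t hs g]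
          comp_assoc[OF t0 s(1) h(1)] comp_assoc[OF t s(1) h(1)] by simp
      \<comment> \<open>With equal injections, copairing identifies any two points of any
        object.\<close>
      then have "y = z" if "y \<in> hom C one W" "z \<in> hom C one W" for W y z
        using coproduct_copair[OF L that] by metis
      then show ?thesis
        by (rule arrows_eq_of_points_eq[OF one f fc])
    qed
  qed
  then show ?thesis
    unfolding c_def by simp
qed

end

section \<open>The inverse of evaluation at a point\<close>

theorem theorem6p1:
  fixes C :: "('o, 'a) cat"
    and one T A E P R :: 'o
    and zero p q r s ev :: 'a
  assumes "topos C" and "NS C" and "WDQO C"
    and "connected C T"
    and "is_terminal C one" and "zero \<in> hom C one T"
    and "decidable C A"
    and "is_exponential C A T E P p q ev"
    and "is_product C E one R r s"
  shows "ev_at C one E r s p q ev zero \<in> hom C E A \<and>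
    is_iso C (ev_at C one E r s p q ev zero)"
proof -
  interpret topos C by fact
  note one = assms(5) and t0 = assms(6) and exp = assms(8) and R = assms(9)
  have P: "is_product C E T P p q" and ev: "ev \<in> hom C P A"
    using exp unfolding is_exponential_def by auto
  have p: "p \<in> hom C P E" and q: "q \<in> hom C P T"
    using P unfolding is_product_def by auto
  have E: "E \<in> obj C" and T: "T \<in> obj C" and A: "A \<in> obj C"
    using p q ev hom_tgt_obj by auto
  note iE = ident_closed[OF E] and iT = ident_closed[OF T] and iA = ident_closed[OF A]
  note bE = bang_in_hom[OF one E] and bA = bang_in_hom[OF one A]
  note oE = comp_closed[OF bE t0] and oA = comp_closed[OF bA t0]
  \<comment> \<open>This is \<open>w \<mapsto> (w, 0)\<close>, the first two arrows of
    \<open>ev_at\<close> merged into one.\<close>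
  define c where "c = pairing C p q (ident C E) (zero \<cdot>\<^bsub>C\<^esub> bang C one E)"
  note c = pairing_props(1)[OF P iE oE, folded c_def]
  define e0 where "e0 = ev \<cdot>\<^bsub>C\<^esub> c"
  have e0: "e0 \<in> hom C E A"
    unfolding e0_def by (rule comp_closed[OF c ev])
  have ev_at: "ev_at C one E r s p q ev zero = e0"
    unfolding ev_at_def e0_def c_def using prod_map_props(2)[OF R P iE t0 iE bE] ident_comp[OF iE] by simp
  \<comment> \<open>On \<open>E \<times> T\<close> this is \<open>(w, t) \<mapsto> (w, 0)\<close>,
    the arrow that \<open>connected_parameter_constant\<close> absorbs into
    \<open>ev\<close>.\<close>
  have "c \<cdot>\<^bsub>C\<^esub> p = pairing C p q p (zero \<cdot>\<^bsub>C\<^esub> bang C one P)"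
    unfolding c_def pairing_comp[OF P iE oE p]
    using ident_comp[OF p] comp_assoc[OF p bE t0] terminal_comp_bang[OF one p] by simp
  then have e0p: "e0 \<cdot>\<^bsub>C\<^esub> p = ev"
    using connected_parameter_constant[OF assms(2,4) one t0 assms(7) P ev] comp_assoc[OF p c ev]
    unfolding e0_def by simp
  obtain Q u v where Q: "is_product C A T Q u v"
    using product_exists[OF A T] .
  have u: "u \<in> hom C Q A" and v: "v \<in> hom C Q T"
    using Q unfolding is_product_def by auto
  \<comment> \<open>\<open>k\<close> sends an element of \<open>A\<close> to the constant function
    with that value.\<close>
  obtain k where k: "k \<in> hom C A E" and evk: "ev \<cdot>\<^bsub>C\<^esub> prod_map C u v p q k (ident C T) = u"
    using exponential_transpose[OF exp Q u] .
  note kT = prod_map_props(1)[OF Q P k iT]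
  have "c \<cdot>\<^bsub>C\<^esub> k = pairing C p q k (zero \<cdot>\<^bsub>C\<^esub> bang C one A)"
    unfolding c_def pairing_comp[OF P iE oE k]
    using ident_comp[OF k] comp_assoc[OF k bE t0] terminal_comp_bang[OF one k] by simp
  \<comment> \<open>Rewritten this way, composing with \<open>ev\<close> evaluates the constant
    function at \<open>0\<close> and returns its value.\<close>
  also have "\<dots> = prod_map C u v p q k (ident C T) \<cdot>\<^bsub>C\<^esub> pairing C u v (ident C A) (zero \<cdot>\<^bsub>C\<^esub> bang C one A)"
    using prod_map_props(2)[OF Q P k iT iA oA] comp_ident[OF k] ident_comp[OF oA] by simp
  finally have e0k: "e0 \<cdot>\<^bsub>C\<^esub> k = ident C A"
    using comp_assoc[OF k c ev] comp_assoc[OF pairing_props(1)[OF Q iA oA] kT ev] evk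
      pairing_props(2)[OF Q iA oA] unfolding e0_def by simp
  note ke0 = comp_closed[OF e0 k]
  \<comment> \<open>Both sides have the same transpose: that of \<open>k \<cdot> e0\<close> is
    \<open>e0 \<cdot> p\<close>, which equals \<open>ev\<close> by \<open>e0p\<close>.\<close>
  have ke: "k \<cdot>\<^bsub>C\<^esub> e0 = ident C E"
  proof (rule exponential_eqI[OF exp P ke0 iE])
    note e0p' = comp_closed[OF p e0]
    have "prod_map C p q p q (k \<cdot>\<^bsub>C\<^esub> e0) (ident C T)
        = prod_map C u v p q k (ident C T) \<cdot>\<^bsub>C\<^esub> pairing C u v (e0 \<cdot>\<^bsub>C\<^esub> p) q"
      using prod_map_props(2)[OF Q P k iT e0p' q] comp_assoc[OF p e0 k]
      unfolding prod_map_def[of C p q] by simp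
    then have "ev \<cdot>\<^bsub>C\<^esub> prod_map C p q p q (k \<cdot>\<^bsub>C\<^esub> e0) (ident C T) = e0 \<cdot>\<^bsub>C\<^esub> p"
      using comp_assoc[OF pairing_props(1)[OF Q e0p' q] kT ev] evk pairing_props(2)[OF Q e0p' q] by simp
    also have "\<dots> = ev \<cdot>\<^bsub>C\<^esub> prod_map C p q p q (ident C E) (ident C T)"
    proof -
      have "prod_map C p q p q (ident C E) (ident C T) = ident C P"
        unfolding prod_map_def
        using pairing_eta[OF P ident_closed[OF product_obj[OF P]]]
          ident_comp[OF p] ident_comp[OF q] comp_ident[OF p] comp_ident[OF q] by simp
      then show ?thesis
        using e0p comp_ident[OF ev] by simp
    qed
    finally show "ev \<cdot>\<^bsub>C\<^esub> prod_map C p q p q (k \<cdot>\<^bsub>C\<^esub> e0) (ident C T)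
      = ev \<cdot>\<^bsub>C\<^esub> prod_map C p q p q (ident C E) (ident C T)" .
  qed
  have "src C e0 = E" "tgt C e0 = A" "e0 \<in> arr C"
    using e0 by (auto simp: hom_def)
  then have "is_iso C e0"
    unfolding is_iso_def using k e0k ke by auto
  then show ?thesis
    using e0 ev_at by simp
qed

end
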